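(* Let $F\neq G$ be two different distribution functions of positive random variables, both monotone increasing and continuous. For each $n$, let $X_{(1)}\le\cdots\le X_{(n)}$ be the order statistics of the first $n$ terms of an i.i.d. sequence with distribution function $F$, and let $Y_{(1)}\le\cdots\le Y_{(n)}$ be the order statistics of the first $n$ terms of an i.i.d. sequence with distribution function $G$, the two sequences being independent. Let $$\alpha_n=\sqrt{\frac{\log n\,\log\log n}{n}},\qquad \beta_n=1-\alpha_n,\qquad \Lambda_m=\{i\in\mathbb{N}:\alpha_n n<i<\beta_n n\}.$$ Then the two limits $$q^{(1)}_{n,\Lambda_m}:=\max_{i\in\Lambda_m}\frac{X_{(i)}}{Y_{(i)}}\xrightarrow{P}1\quad\text{and}\quad q^{(2)}_{n,\Lambda_m}:=\max_{i\in\Lambda_m}\frac{Y_{(i)}}{X_{(i)}}\xrightarrow{P}1\qquad(n\to\infty)$$ cannot hold simultaneously.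
   Context: $\xrightarrow{P}$ denotes convergence in probability. All quantities are considered for $n$ large enough that $\alpha_n<\beta_n$ and $\Lambda_m$ is nonempty. "Monotone increasing" is understood on the support (in the positive half-line) of the respective distribution. The subscript $m$ in $\Lambda_m$ stands for "middle" and is not an index. *)

theory Defs
  imports "HOL-Probability.Probability"
begin

(* The topological support of the law with distribution function F
   (interval_measure F is that law whenever F is a distribution function). *)
definition df_support :: "(real \<Rightarrow> real) \<Rightarrow> real set" where
  "df_support F = {x. \<forall>U. open U \<longrightarrow> x \<in> U \<longrightarrow> 0 < emeasure (interval_measure F) U}"

(* The random variables are indexed from 0, so the first n terms are Z 0, ..., Z (n - 1);
   order statistics are indexed from 1, so only 1 \<le> i \<le> n is meaningful. *)
definition order_stat :: "(nat \<Rightarrow> 'a \<Rightarrow> real) \<Rightarrow> nat \<Rightarrow> nat \<Rightarrow> 'a \<Rightarrow> real" where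
  "order_stat Z n i \<omega> = sort (map (\<lambda>j. Z j \<omega>) [0..<n]) ! (i - 1)"

definition alpha :: "nat \<Rightarrow> real" where
  "alpha n = sqrt (ln (real n) * ln (ln (real n)) / real n)"

definition beta :: "nat \<Rightarrow> real" where
  "beta n = 1 - alpha n"

definition Lambda_m :: "nat \<Rightarrow> nat set" where
  "Lambda_m n = {i. alpha n * real n < real i \<and> real i < beta n * real n}"

(* Lambda_m n may be empty for finitely many n, where Max is unspecified;
   this does not affect limits as n tends to infinity. *)
definition max_ratio ::
    "(nat \<Rightarrow> 'a \<Rightarrow> real) \<Rightarrow> (nat \<Rightarrow> 'a \<Rightarrow> real) \<Rightarrow> nat \<Rightarrow> 'a \<Rightarrow> real" where
  "max_ratio X Y n \<omega> = (MAX i\<in>Lambda_m n. order_stat X n i \<omega> / order_stat Y n i \<omega>)"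

definition tendsto_in_prob :: "'a measure \<Rightarrow> (nat \<Rightarrow> 'a \<Rightarrow> real) \<Rightarrow> real \<Rightarrow> bool" where
  "tendsto_in_prob M Z c \<longleftrightarrow>
     (\<forall>\<epsilon>>0. (\<lambda>n. measure M {\<omega> \<in> space M. \<bar>Z n \<omega> - c\<bar> > \<epsilon>}) \<longlonglongrightarrow> 0)"

end

theory Submission
  imports Defs "HOL-Real_Asymp.Real_Asymp"
begin

text \<open>
  If two distribution functions differ, there is a point \<open>x\<close> at which one is strictly smaller,
  say \<open>F x < G x\<close>, and hence a level \<open>u\<close> strictly in between. By continuity of \<open>G\<close> there is
  even a point \<open>y < x\<close> with \<open>u < G y\<close>. At level \<open>u\<close> the quantiles are thus separated:
  that of \<open>F\<close> lies above \<open>x\<close>, that of \<open>G\<close> lies in \<open>{0<..y}\<close>. The order statistics with index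
  \<open>\<lceil>u n\<rceil>\<close> inherit this separation with probability tending to \<open>1\<close>: since
  \<open>X\<^bsub>(i)\<^esub> \<le> x\<close> says that at least \<open>i\<close> of the first \<open>n\<close> variables are at most \<open>x\<close>
  (\<open>order_stat_le_iff\<close>), Hoeffding's inequality for such counts applies
  (\<open>order_stat_le_below_quantile\<close>, \<open>order_stat_gt_above_quantile\<close>). As \<open>0 < u < 1\<close> and
  \<open>\<alpha>\<^sub>n \<rightarrow> 0\<close>, this index eventually belongs to the middle range, so the maximum of
  \<open>X\<^bsub>(i)\<^esub> / Y\<^bsub>(i)\<^esub>\<close> exceeds \<open>x / y > 1\<close> with probability tending to \<open>1\<close>. When instead
  \<open>G x < F x\<close>, the roles of the samples are exchanged, and the other limit fails.

  The three bad events (\<open>X\<^bsub>(i)\<^esub>\<close> too small, \<open>Y\<^bsub>(i)\<^esub>\<close> too large, \<open>Y\<^bsub>(i)\<^esub>\<close> not positive) are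
  combined by a union bound.
\<close>

section \<open>Order statistics as counts\<close>

lemma sorted_nth_le_iff_length_filter:
  fixes xs :: "'b::linorder list"
  assumes "sorted xs" and "k < length xs"
  shows "xs ! k \<le> x \<longleftrightarrow> k < length (filter (\<lambda>y. y \<le> x) xs)"
proof
  assume le: "xs ! k \<le> x"
  have "{..k} \<subseteq> {i. i < length xs \<and> xs ! i \<le> x}"
    using le assms by (auto dest: sorted_nth_mono[of xs _ k])
  then have "card {..k} \<le> card {i. i < length xs \<and> xs ! i \<le> x}"
    by (intro card_mono) auto
  then show "k < length (filter (\<lambda>y. y \<le> x) xs)"
    by (simp add: length_filter_conv_card)
next
  assume less: "k < length (filter (\<lambda>y. y \<le> x) xs)"
  show "xs ! k \<le> x"
  proof (rule ccontr)
    assume gt: "\<not> xs ! k \<le> x"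
    have "{i. i < length xs \<and> xs ! i \<le> x} \<subseteq> {..<k}"
    proof (rule subsetI, rule ccontr)
      fix i assume i: "i \<in> {i. i < length xs \<and> xs ! i \<le> x}" "i \<notin> {..<k}"
      then have "xs ! k \<le> xs ! i"
        using assms by (intro sorted_nth_mono) auto
      with i gt show False by auto
    qed
    then have "card {i. i < length xs \<and> xs ! i \<le> x} \<le> card {..<k}"
      by (intro card_mono) auto
    with less show False
      by (simp add: length_filter_conv_card)
  qed
qed

lemma order_stat_le_iff:
  assumes "1 \<le> i" and "i \<le> n"
  shows "order_stat Z n i \<omega> \<le> x \<longleftrightarrow> real i \<le> (\<Sum>j<n. indicator {..x} (Z j \<omega>))"
proof -
  let ?zs = "map (\<lambda>j. Z j \<omega>) [0..<n]"
  have "length (filter (\<lambda>y. y \<le> x) ?zs) = card {j \<in> {..<n}. Z j \<omega> \<le> x}"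
    unfolding length_filter_conv_card by (rule arg_cong[where f = card]) auto
  moreover have "(\<Sum>j<n. indicator {..x} (Z j \<omega>)) = real (card {j \<in> {..<n}. Z j \<omega> \<le> x})"
  proof -
    have "(\<Sum>j<n. indicator {..x} (Z j \<omega>)) = (\<Sum>j\<in>{j \<in> {..<n}. Z j \<omega> \<le> x}. 1::real)"
      by (intro sum.mono_neutral_cong_right) (auto simp: indicator_def)
    then show ?thesis by simp
  qed
  moreover have "order_stat Z n i \<omega> \<le> x \<longleftrightarrow> i - 1 < length (filter (\<lambda>y. y \<le> x) (sort ?zs))"
    unfolding order_stat_def using assms by (intro sorted_nth_le_iff_length_filter) auto
  ultimately show ?thesis
    using assms by (auto simp: filter_sort)
qed

text \<open>
  A count is an integer, so the ceiling loses nothing: reaching \<open>\<lceil>u n\<rceil>\<close> and reaching \<open>u n\<close> are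
  the same.
\<close>

lemma order_stat_le_iff_empirical_cdf:
  assumes "0 < u" and "u \<le> 1" and "n > 0"
  shows "order_stat Z n (nat \<lceil>u * real n\<rceil>) \<omega> \<le> x
    \<longleftrightarrow> u \<le> (\<Sum>j<n. indicator {..x} (Z j \<omega>)) / real n"
proof -
  let ?i = "nat \<lceil>u * real n\<rceil>"
  have "0 < u * real n" and "u * real n \<le> real n"
    using assms by (simp_all add: mult_left_le_one_le)
  then have "1 \<le> ?i" and "?i \<le> n"
    by linarith+
  moreover have "(\<Sum>j<n. indicator {..x} (Z j \<omega>)) = real (\<Sum>j<n. indicator {..x} (Z j \<omega>))"
    by (simp add: indicator_def)
  moreover have "real ?i \<le> real k \<longleftrightarrow> u * real n \<le> real k" for k :: nat
    by (simp add: nat_le_iff ceiling_le_iff)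
  ultimately have "order_stat Z n ?i \<omega> \<le> x \<longleftrightarrow> u * real n \<le> (\<Sum>j<n. indicator {..x} (Z j \<omega>))"
    by (metis order_stat_le_iff)
  with \<open>n > 0\<close> show ?thesis
    by (simp add: pos_le_divide_eq)
qed

lemma borel_measurable_order_stat:
  assumes [measurable]: "\<And>j. Z j \<in> borel_measurable M" and "1 \<le> i" and "i \<le> n"
  shows "order_stat Z n i \<in> borel_measurable M"
  unfolding borel_measurable_iff_le order_stat_le_iff[OF assms(2,3)] by measurable

section \<open>Concentration of order statistics at quantiles\<close>

context prob_space
begin

text \<open>
  The indicators of \<open>Z j \<le> x\<close> are independent copies of a variable with values in \<open>{0, 1}\<close>
  and mean \<open>F x\<close>; Hoeffding's inequality controls the empirical distribution function.
\<close>

lemma empirical_cdf_deviation: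
  assumes indep: "indep_vars (\<lambda>_. borel) Z UNIV"
    and cdf: "\<And>j. cdf (distr M borel (Z j)) = F"
    and "n > 0" and "d \<ge> 0"
  shows "prob {\<omega> \<in> space M. (\<Sum>j<n. indicator {..x} (Z j \<omega>)) / real n \<ge> F x + d}
           \<le> exp (- 2 * real n * d\<^sup>2)" (is ?upper)
    and "prob {\<omega> \<in> space M. (\<Sum>j<n. indicator {..x} (Z j \<omega>)) / real n \<le> F x - d}
           \<le> exp (- 2 * real n * d\<^sup>2)" (is ?lower)
proof -
  have [measurable]: "random_variable borel (Z j)" for j
    using indep unfolding indep_vars_def by simp
  have distr: "distr M borel (Z j) = distr M borel (Z 0)" for j
    by (rule cdf_unique) (simp_all add: cdf real_distribution_distr)
  have mean: "F x = expectation (\<lambda>\<omega>. indicator {..x} (Z 0 \<omega>) :: real)"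
  proof -
    have "F x = measure (distr M borel (Z 0)) {..x}"
      using cdf[of 0] by (simp add: cdf_def fun_eq_iff)
    also have "\<dots> = integral\<^sup>L (distr M borel (Z 0)) (indicator {..x})"
      by simp
    also have "\<dots> = expectation (\<lambda>\<omega>. indicator {..x} (Z 0 \<omega>))"
      by (rule integral_distr) auto
    finally show ?thesis .
  qed
  interpret Hoeffding_ineq_iid M "{..<n}" "\<lambda>j \<omega>. indicator {..x} (Z j \<omega>)"
    "\<lambda>\<omega>. indicator {..x} (Z 0 \<omega>)" 0 1 "F x"
  proof unfold_locales
    show "indep_vars (\<lambda>_. borel) (\<lambda>j \<omega>. indicator {..x} (Z j \<omega>) :: real) {..<n}"
      by (rule indep_vars_compose2[OF indep_vars_subset[OF indep]]) auto
    fix j assume "j \<in> {..<n}"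
    have push: "distr M borel (\<lambda>\<omega>. indicator {..x} (Z k \<omega>) :: real)
        = distr (distr M borel (Z k)) borel (indicator {..x})" for k
      by (subst distr_distr) (auto simp: o_def)
    show "distr M borel (\<lambda>\<omega>. indicator {..x} (Z j \<omega>) :: real)
        = distr M borel (\<lambda>\<omega>. indicator {..x} (Z 0 \<omega>))"
      unfolding push distr[of j] ..
  qed (auto simp: mean indicator_def)
  have "{..<n} \<noteq> {}" using \<open>n > 0\<close> by auto
  then show ?upper and ?lower
    using Hoeffding_ineq_ge'[OF \<open>d \<ge> 0\<close>] Hoeffding_ineq_le'[OF \<open>d \<ge> 0\<close>] by simp_all
qed

text \<open>
  For the order statistic to lie on the wrong side of \<open>x\<close>, the empirical distribution function
  at \<open>x\<close> has to deviate from its mean \<open>F x\<close> by at least \<open>\<bar>u - F x\<bar>\<close>, which does not depend on \<open>n\<close>.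
\<close>

lemma order_stat_le_below_quantile:
  assumes indep: "indep_vars (\<lambda>_. borel) Z UNIV"
    and cdf: "\<And>j. cdf (distr M borel (Z j)) = F"
    and "0 < u" and "u \<le> 1" and "F x < u"
  shows "(\<lambda>n. prob {\<omega> \<in> space M. order_stat Z n (nat \<lceil>u * real n\<rceil>) \<omega> \<le> x}) \<longlonglongrightarrow> 0"
proof (rule Lim_null_comparison)
  define d where "d = u - F x"
  have "d > 0" using assms by (simp add: d_def)
  then show "(\<lambda>n. exp (- 2 * real n * d\<^sup>2)) \<longlonglongrightarrow> 0"
    by real_asymp
  show "\<forall>\<^sub>F n in sequentially.
      norm (prob {\<omega> \<in> space M. order_stat Z n (nat \<lceil>u * real n\<rceil>) \<omega> \<le> x})
        \<le> exp (- 2 * real n * d\<^sup>2)"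
    using eventually_gt_at_top[of 0]
  proof eventually_elim
    case (elim n)
    show ?case
      using empirical_cdf_deviation(1)[OF indep cdf elim less_imp_le[OF \<open>d > 0\<close>], of x]
      by (simp add: order_stat_le_iff_empirical_cdf assms elim d_def)
  qed
qed

lemma order_stat_gt_above_quantile:
  assumes indep: "indep_vars (\<lambda>_. borel) Z UNIV"
    and cdf: "\<And>j. cdf (distr M borel (Z j)) = F"
    and "0 < u" and "u \<le> 1" and "u < F x"
  shows "(\<lambda>n. prob {\<omega> \<in> space M. x < order_stat Z n (nat \<lceil>u * real n\<rceil>) \<omega>}) \<longlonglongrightarrow> 0"
proof (rule Lim_null_comparison)
  define d where "d = F x - u"
  have "d > 0" using assms by (simp add: d_def)
  then show "(\<lambda>n. exp (- 2 * real n * d\<^sup>2)) \<longlonglongrightarrow> 0"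
    by real_asymp
  have [measurable]: "random_variable borel (Z j)" for j
    using indep unfolding indep_vars_def by simp
  show "\<forall>\<^sub>F n in sequentially.
      norm (prob {\<omega> \<in> space M. x < order_stat Z n (nat \<lceil>u * real n\<rceil>) \<omega>})
        \<le> exp (- 2 * real n * d\<^sup>2)"
    using eventually_gt_at_top[of 0]
  proof eventually_elim
    case (elim n)
    have "prob {\<omega> \<in> space M. x < order_stat Z n (nat \<lceil>u * real n\<rceil>) \<omega>}
        \<le> prob {\<omega> \<in> space M. (\<Sum>j<n. indicator {..x} (Z j \<omega>)) / real n \<le> F x - d}"
    proof (intro finite_measure_mono)
      have "x < order_stat Z n (nat \<lceil>u * real n\<rceil>) \<omega>
          \<longleftrightarrow> (\<Sum>j<n. indicator {..x} (Z j \<omega>)) / real n < u" for \<omega>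
        using order_stat_le_iff_empirical_cdf[OF assms(3,4) elim] by (metis not_le)
      then show "{\<omega> \<in> space M. x < order_stat Z n (nat \<lceil>u * real n\<rceil>) \<omega>}
          \<subseteq> {\<omega> \<in> space M. (\<Sum>j<n. indicator {..x} (Z j \<omega>)) / real n \<le> F x - d}"
        by (auto simp: d_def)
    qed measurable
    also have "\<dots> \<le> exp (- 2 * real n * d\<^sup>2)"
      by (rule empirical_cdf_deviation(2)[OF indep cdf elim less_imp_le[OF \<open>d > 0\<close>]])
    finally show ?case by simp
  qed
qed

end

section \<open>The middle range\<close>

lemma finite_Lambda_m: "finite (Lambda_m n)"
  by (rule finite_subset[of _ "{..nat \<lceil>beta n * real n\<rceil>}"]) (auto simp: Lambda_m_def, linarith)

lemma alpha_tendsto_0: "alpha \<longlonglongrightarrow> 0"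
  unfolding alpha_def by real_asymp

lemma eventually_Lambda_m_subset: "\<forall>\<^sub>F n in sequentially. Lambda_m n \<subseteq> {1..n}"
proof -
  have "\<forall>\<^sub>F n in sequentially. 0 < alpha n"
    unfolding alpha_def by real_asymp
  then show ?thesis
  proof eventually_elim
    case (elim n)
    show ?case
    proof
      fix i assume "i \<in> Lambda_m n"
      then have i: "alpha n * real n < real i" "real i < real n - alpha n * real n"
        by (auto simp: Lambda_m_def beta_def algebra_simps)
      moreover have "0 \<le> alpha n * real n"
        using elim by simp
      ultimately show "i \<in> {1..n}" by auto
    qed
  qed
qed

lemma eventually_level_in_Lambda_m:
  assumes "0 < u" and "u < 1"
  shows "\<forall>\<^sub>F n in sequentially. nat \<lceil>u * real n\<rceil> \<in> Lambda_m n"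
proof -
  have "(\<lambda>n. alpha n + 1 / real n) \<longlonglongrightarrow> 0 + 0"
    by (intro tendsto_add alpha_tendsto_0 lim_1_over_n)
  then have "\<forall>\<^sub>F n in sequentially. alpha n + 1 / real n < 1 - u"
    using assms by (intro order_tendstoD(2)) auto
  moreover have "\<forall>\<^sub>F n in sequentially. alpha n < u"
    by (rule order_tendstoD(2)[OF alpha_tendsto_0 \<open>0 < u\<close>])
  ultimately show ?thesis
    using eventually_gt_at_top[of 0]
  proof eventually_elim
    case (elim n)
    have n: "0 < real n" using elim by simp
    have "(alpha n + 1 / real n) * real n < (1 - u) * real n"
      using elim n by (intro mult_strict_right_mono)
    then have "u * real n + 1 < beta n * real n"
      using n by (simp add: beta_def algebra_simps)
    moreover have "alpha n * real n < u * real n"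
      using elim n by simp
    moreover have "0 < u * real n"
      using n assms by simp
    ultimately show ?case
      unfolding Lambda_m_def by (simp, linarith)
  qed
qed

section \<open>Failure of one limit\<close>

text \<open>
  Non-measurable sets have measure \<open>0\<close> by default. Measurability of the maximum is therefore what
  allows a lower bound on the probability that it deviates from its limit.
\<close>

lemma borel_measurable_max_ratio:
  assumes "\<And>j. X j \<in> borel_measurable M" and "\<And>j. Y j \<in> borel_measurable M"
    and "Lambda_m n \<subseteq> {1..n}"
  shows "max_ratio X Y n \<in> borel_measurable M"
  unfolding max_ratio_def[abs_def] using assms
  by (intro borel_measurable_Max borel_measurable_divide borel_measurable_order_stat finite_Lambda_m)
    auto

context prob_space
begin

lemma cdf_eq_0_if_nonpos:
  assumes [measurable]: "random_variable borel Z"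
    and "AE \<omega> in M. 0 < Z \<omega>" and "x \<le> 0"
  shows "cdf (distr M borel Z) x = 0"
proof -
  have "cdf (distr M borel Z) x = prob {\<omega> \<in> space M. Z \<omega> \<le> x}"
    by (simp add: cdf_def measure_distr vimage_def Int_def conj_commute)
  also have "\<dots> = 0"
    using assms(2) by (intro measure_eq_0_null_sets AE_iff_null_sets[THEN iffD2]) (use assms(3) in auto)
  finally show ?thesis .
qed

text \<open>
  The order statistics at level \<open>u\<close>, for \<open>u\<close> strictly between \<open>F x\<close> and \<open>G x\<close>, concentrate on
  opposite sides of a gap from \<open>y\<close> to \<open>x\<close>. Continuity of \<open>G\<close> provides this gap; positivity of
  the denominators turns it into a ratio bounded away from \<open>1\<close>.
\<close>

lemma max_ratio_not_tendsto_1: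
  assumes indep_X: "indep_vars (\<lambda>_. borel) X UNIV"
    and indep_Y: "indep_vars (\<lambda>_. borel) Y UNIV"
    and cdf_X: "\<And>j. cdf (distr M borel (X j)) = F"
    and cdf_Y: "\<And>j. cdf (distr M borel (Y j)) = G"
    and pos_Y: "AE \<omega> in M. 0 < Y 0 \<omega>"
    and cont: "isCont G x"
    and less: "F x < G x"
  shows "\<not> tendsto_in_prob M (max_ratio X Y) 1"
proof
  assume lim: "tendsto_in_prob M (max_ratio X Y) 1"
  have rv_X: "random_variable borel (X j)" and rv_Y: "random_variable borel (Y j)" for j
    using indep_X indep_Y unfolding indep_vars_def by simp_all
  interpret dX: prob_space "distr M borel (X 0)" by (rule prob_space_distr[OF rv_X])
  interpret dY: prob_space "distr M borel (Y 0)" by (rule prob_space_distr[OF rv_Y])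
  obtain u where u: "F x < u" "u < G x"
    using dense[OF less] by blast
  have "0 \<le> F x" "G x \<le> 1"
    using dX.prob_le_1 dY.prob_le_1 unfolding cdf_X[of 0, symmetric] cdf_Y[of 0, symmetric]
    by (simp_all add: cdf_def)
  with u have u01: "0 < u" "u < 1" by linarith+
  have G0: "G z = 0" if "z \<le> 0" for z
    using cdf_eq_0_if_nonpos[OF rv_Y pos_Y that] by (simp add: cdf_Y)

  have "\<forall>\<^sub>F y in at_left x. u < G y"
    by (rule order_tendstoD(1)[OF tendsto_within_subset[OF cont[unfolded isCont_def]] u(2)]) simp
  then obtain y where y: "y < x" "u < G y"
    unfolding eventually_at_left_field using dense by blast
  have "0 < y"
    using G0[of y] y(2) u01 by (cases "y \<le> 0") auto

  \<comment> \<open>Half of the excess \<open>x / y - 1\<close>, so that the deviation from \<open>1\<close> is strict.\<close>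
  define \<epsilon> where "\<epsilon> = (x / y - 1) / 2"
  have \<epsilon>: "0 < \<epsilon>" "1 + \<epsilon> < x / y"
    using y \<open>0 < y\<close> by (auto simp: \<epsilon>_def field_simps)
  define i where "i n = nat \<lceil>u * real n\<rceil>" for n
  define A where "A n = {\<omega> \<in> space M. order_stat X n (i n) \<omega> \<le> x}" for n
  define B where "B n = {\<omega> \<in> space M. y < order_stat Y n (i n) \<omega>}" for n
  define C where "C n = {\<omega> \<in> space M. order_stat Y n (i n) \<omega> \<le> 0}" for n
  define E where "E n = {\<omega> \<in> space M. \<bar>max_ratio X Y n \<omega> - 1\<bar> > \<epsilon>}" for n

  have "(\<lambda>n. prob (A n)) \<longlonglongrightarrow> 0"
    unfolding A_def i_def
    using order_stat_le_below_quantile[OF indep_X cdf_X] u u01 by auto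
  moreover have "(\<lambda>n. prob (B n)) \<longlonglongrightarrow> 0"
    unfolding B_def i_def
    using order_stat_gt_above_quantile[OF indep_Y cdf_Y] y u01 by auto
  moreover have "(\<lambda>n. prob (C n)) \<longlonglongrightarrow> 0"
    unfolding C_def i_def
    using order_stat_le_below_quantile[OF indep_Y cdf_Y] G0[of 0] u01 by auto
  moreover have "(\<lambda>n. prob (E n)) \<longlonglongrightarrow> 0"
    unfolding E_def using lim \<epsilon>(1) by (auto simp: tendsto_in_prob_def)
  ultimately have "(\<lambda>n. prob (A n) + prob (B n) + prob (C n) + prob (E n)) \<longlonglongrightarrow> 0 + 0 + 0 + 0"
    by (intro tendsto_add)
  moreover have "\<forall>\<^sub>F n in sequentially. 1 \<le> prob (A n) + prob (B n) + prob (C n) + prob (E n)"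
    using eventually_Lambda_m_subset eventually_level_in_Lambda_m[OF u01]
  proof eventually_elim
    case (elim n)
    have i_in: "i n \<in> Lambda_m n" using elim by (simp add: i_def)
    then have i: "1 \<le> i n" "i n \<le> n" using elim by auto
    note [measurable] = borel_measurable_order_stat[OF rv_X i] borel_measurable_order_stat[OF rv_Y i]
      borel_measurable_max_ratio[OF rv_X rv_Y elim(1)]
    have [measurable]: "A n \<in> events" "B n \<in> events" "C n \<in> events" "E n \<in> events"
      unfolding A_def B_def C_def E_def by measurable
    have "space M \<subseteq> A n \<union> B n \<union> C n \<union> E n"
    proof
      fix \<omega> assume \<omega>: "\<omega> \<in> space M"
      show "\<omega> \<in> A n \<union> B n \<union> C n \<union> E n"
      proof (rule ccontr)
        assume out: "\<omega> \<notin> A n \<union> B n \<union> C n \<union> E n"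
        let ?X = "order_stat X n (i n) \<omega>" and ?Y = "order_stat Y n (i n) \<omega>"
        have "x < ?X" "?Y \<le> y" "0 < ?Y" and E: "max_ratio X Y n \<omega> \<le> 1 + \<epsilon>"
          using out \<omega> by (auto simp: A_def B_def C_def E_def)
        then have "x / y \<le> ?X / ?Y"
          using y \<open>0 < y\<close> by (intro frac_le) auto
        also have "\<dots> \<le> max_ratio X Y n \<omega>"
          unfolding max_ratio_def using i_in finite_Lambda_m by (intro Max_ge) auto
        finally show False using E \<epsilon>(2) by linarith
      qed
    qed
    then have "1 \<le> prob (A n \<union> B n \<union> C n \<union> E n)"
      using finite_measure_mono[of "space M" "A n \<union> B n \<union> C n \<union> E n"] by (simp add: prob_space)
    also have "\<dots> \<le> prob (A n) + prob (B n) + prob (C n) + prob (E n)"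
      by (intro order_trans[OF measure_Un_le] add_right_mono) auto
    finally show ?case .
  qed
  ultimately have "(1::real) \<le> 0 + 0 + 0 + 0"
    by (intro tendsto_lowerbound) auto
  then show False by simp
qed

end

theorem theorem2p5:
  fixes M :: "'a measure"
    and X Y :: "nat \<Rightarrow> 'a \<Rightarrow> real"
    and F G :: "real \<Rightarrow> real"
  assumes "prob_space M"
    and "F \<noteq> G"
    and "continuous_on UNIV F" and "continuous_on UNIV G"
    and "strict_mono_on (df_support F \<inter> {0<..}) F"
    and "strict_mono_on (df_support G \<inter> {0<..}) G"
    and "prob_space.indep_vars M (\<lambda>_. borel) X UNIV"
    and "prob_space.indep_vars M (\<lambda>_. borel) Y UNIV"
    and "\<And>i. cdf (distr M borel (X i)) = F"
    and "\<And>i. cdf (distr M borel (Y i)) = G"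
    and "\<And>i. AE \<omega> in M. 0 < X i \<omega>"
    and "\<And>i. AE \<omega> in M. 0 < Y i \<omega>"
    and "prob_space.indep_var M
           (\<Pi>\<^sub>M i\<in>UNIV. borel) (\<lambda>\<omega> i. X i \<omega>)
           (\<Pi>\<^sub>M i\<in>UNIV. borel) (\<lambda>\<omega> i. Y i \<omega>)"
  shows "\<not> (tendsto_in_prob M (max_ratio X Y) 1 \<and> tendsto_in_prob M (max_ratio Y X) 1)"
proof -
  interpret prob_space M by fact
  obtain x where "F x \<noteq> G x"
    using \<open>F \<noteq> G\<close> by blast
  moreover have "isCont F x" "isCont G x"
    using assms(3,4) by (simp_all add: continuous_on_eq_continuous_at)
  ultimately show ?thesis
    using max_ratio_not_tendsto_1[OF assms(7,8,9,10,12)]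
      max_ratio_not_tendsto_1[OF assms(8,7,10,9,11)]
    by (cases "F x < G x") (auto simp: not_less)
qed

end
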